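(* The merge algorithm described in the context solves the monotone price-setting subproblem $$\min_{p_1,\ldots,p_\kappa\in\mathbb{R}}\ \sum_{k=1}^{\kappa}\sum_{d\in D_k}t_d\,\vert r_d-p_k\vert\quad\text{s.t.}\quad 0\le p_1,\quad p_k\le p_{k+1}\ \text{ for all }k\in\{1,\ldots,\kappa-1\}$$ (i.e., the price-setting subproblem requiring monotonically increasing prices, thus satisfying the no-elongation property) in $\mathcal{O}(\kappa\cdot\vert D\vert)$ time.
   Context: Data: a finite set $D$ of OD (origin-destination) pairs with reference prices $r_d\in\mathbb{R}_{\ge0}$ and passenger numbers $t_d\in\mathbb{N}_{\ge1}$ for $d\in D$, and a partition of $D$ into non-empty sets $D_1,\ldots,D_\kappa$. (In the application, a zone partition of the stations of a network is fixed, $D_k$ is the set of OD pairs whose path traverses exactly $k$ zones, $\kappa$ is the maximum number of traversed zones, and $p_k$ is the price for traversing $k$ zones. A zone tariff satisfies the no-elongation property, i.e., extending a path by one further node never decreases its price, if its price function is monotonically increasing. "Increasing" is meant in the weak sense.) For $D'\subseteq D$, the set of weighted medians $\textsf{w-median}(D')$ consists of all $\bar p$ with $\sum_{d\in D':\,r_d<\bar p}t_d\le\frac12\sum_{d\in D'}t_d$ and $\sum_{d\in D':\,r_d>\bar p}t_d\le\frac12\sum_{d\in D'}t_d$. A weighted median of $D'$ can be computed in time $\mathcal{O}(\vert D'\vert)$. Algorithm (lists are indexed from 1): 1. Initialize the list of index sets $I\leftarrow[\{1\},\ldots,\{\kappa\}]$, the list of sets of OD pairs $\mathcal{D}\leftarrow[D_1,\ldots,D_\kappa]$,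 the list of price levels $P\leftarrow[p_1,\ldots,p_\kappa]$ with some $p_k\in\textsf{w-median}(D_k)$ for each $k$, and $k\leftarrow1$. 2. While $k\neq\mathrm{length}(P)$: - If $P[k]>P[k+1]$ (merge operation): set $I[k]\leftarrow I[k]\cup I[k+1]$, $\mathcal{D}[k]\leftarrow\mathcal{D}[k]\cup\mathcal{D}[k+1]$, $P[k]\leftarrow$ some element of $\textsf{w-median}(\mathcal{D}[k])$ (for the updated $\mathcal{D}[k]$); delete the entries at position $k+1$ from $I$, $\mathcal{D}$ and $P$; and if $k\neq1$, set $k\leftarrow k-1$. - Otherwise (move operation): set $k\leftarrow k+1$. 3. For each $l=1,\ldots,\mathrm{length}(P)$ and each $k\in I[l]$ set $p_k\leftarrow P[l]$. Return $(p_1,\ldots,p_\kappa)$. *)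

theory Defs
  imports Complex_Main "HOL-Library.Disjoint_Sets" "HOL-Library.State_Monad"
    "HOL-Library.While_Combinator"
begin

section \<open>The monotone price-setting subproblem\<close>

definition pricing_instance ::
  "'d set \<Rightarrow> ('d \<Rightarrow> real) \<Rightarrow> ('d \<Rightarrow> nat) \<Rightarrow> nat \<Rightarrow> (nat \<Rightarrow> 'd set) \<Rightarrow> bool" where
  "pricing_instance D r t \<kappa> Dk \<longleftrightarrow>
     finite D \<and> (\<forall>d\<in>D. 0 \<le> r d) \<and> (\<forall>d\<in>D. 1 \<le> t d) \<and> 1 \<le> \<kappa> \<and>
     (\<Union>k\<in>{1..\<kappa>}. Dk k) = D \<and> disjoint_family_on Dk {1..\<kappa>} \<and> (\<forall>k\<in>{1..\<kappa>}. Dk k \<noteq> {})"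

text \<open>
  A price vector $(p_1, \ldots, p_\kappa)$ is a function on the natural numbers of which only the
  values at \<open>1, \<dots>, \<kappa>\<close> are relevant.
\<close>

definition total_deviation ::
  "('d \<Rightarrow> real) \<Rightarrow> ('d \<Rightarrow> nat) \<Rightarrow> nat \<Rightarrow> (nat \<Rightarrow> 'd set) \<Rightarrow> (nat \<Rightarrow> real) \<Rightarrow> real" where
  "total_deviation r t \<kappa> Dk p = (\<Sum>k = 1..\<kappa>. \<Sum>d\<in>Dk k. real (t d) * \<bar>r d - p k\<bar>)"

definition monotone_prices :: "nat \<Rightarrow> (nat \<Rightarrow> real) \<Rightarrow> bool" where
  "monotone_prices \<kappa> p \<longleftrightarrow> 0 \<le> p 1 \<and> (\<forall>k\<in>{1..\<kappa> - 1}. p k \<le> p (k + 1))"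

definition w_median :: "('d \<Rightarrow> real) \<Rightarrow> ('d \<Rightarrow> nat) \<Rightarrow> 'd set \<Rightarrow> real set" where
  "w_median r t D' = {p.
     (\<Sum>d | d \<in> D' \<and> r d < p. real (t d)) \<le> 1/2 * (\<Sum>d\<in>D'. real (t d)) \<and>
     (\<Sum>d | d \<in> D' \<and> r d > p. real (t d)) \<le> 1/2 * (\<Sum>d\<in>D'. real (t d))}"

text \<open>
  The weighted-median subroutine is a parameter: on a non-empty set \<open>D'\<close> of OD pairs it returns
  \<open>med D'\<close> after \<open>T_med D'\<close> elementary operations. Letting \<open>med\<close> be an arbitrary function of \<open>D'\<close>
  covers every way of making the arbitrary choices of medians in a run of the algorithm, because
  no set is passed to the subroutine twice: the sets \<open>Dk k\<close> are non-empty and disjoint, and every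
  later argument is the union of two disjoint non-empty sets in the current list.
\<close>

definition linear_time_median ::
  "real \<Rightarrow> 'd set \<Rightarrow> ('d \<Rightarrow> real) \<Rightarrow> ('d \<Rightarrow> nat) \<Rightarrow> ('d set \<Rightarrow> real) \<Rightarrow> ('d set \<Rightarrow> nat) \<Rightarrow> bool" where
  "linear_time_median c D r t med T_med \<longleftrightarrow>
     (\<forall>D'. D' \<subseteq> D \<and> D' \<noteq> {} \<longrightarrow>
        med D' \<in> w_median r t D' \<and> real (T_med D') \<le> c * real (card D'))"

section \<open>Programs with a step counter\<close>

text \<open>
  Programs live in the state monad whose state is the number of elementary operations performed
  so far. Tests and arithmetic on numbers cost 1. Every access to a list (reading or
  writing one entry, deleting one entry, determining the length) is charged the length of the list,
  an upper bound for both arrays and linked lists; forming the union of two sets is charged the sum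
  of their cardinalities.
\<close>

type_synonym 'a timed = "(nat, 'a) state"

definition charge :: "nat \<Rightarrow> 'a \<Rightarrow> 'a timed" where
  "charge n x = do { State_Monad.update (\<lambda>\<tau>. \<tau> + n); State_Monad.return x }"

text \<open>Positions in lists are counted from 1.\<close>

definition read_at :: "'a list \<Rightarrow> nat \<Rightarrow> 'a timed" where
  "read_at xs k = charge (length xs) (xs ! (k - 1))"

definition write_at :: "'a list \<Rightarrow> nat \<Rightarrow> 'a \<Rightarrow> 'a list timed" where
  "write_at xs k x = charge (length xs) (xs[k - 1 := x])"

definition delete_at :: "'a list \<Rightarrow> nat \<Rightarrow> 'a list timed" where
  "delete_at xs k = charge (length xs) (take (k - 1) xs @ drop k xs)"

definition length_of :: "'a list \<Rightarrow> nat timed" where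
  "length_of xs = charge (length xs) (length xs)"

definition unite :: "'a set \<Rightarrow> 'a set \<Rightarrow> 'a set timed" where
  "unite A B = charge (card A + card B) (A \<union> B)"

primrec for_each :: "('x \<Rightarrow> 'a \<Rightarrow> 'a timed) \<Rightarrow> 'x list \<Rightarrow> 'a \<Rightarrow> 'a timed" where
  "for_each f [] a = State_Monad.return a"
| "for_each f (x # xs) a = do { a' \<leftarrow> f x a; for_each f xs a' }"

text \<open>
  The loop yields \<open>None\<close> iff it does not terminate. Every evaluation of the test is paid for,
  including the last one.
\<close>

definition timed_while ::
  "('s \<Rightarrow> bool timed) \<Rightarrow> ('s \<Rightarrow> 's timed) \<Rightarrow> 's \<times> nat \<Rightarrow> ('s \<times> nat) option" where
  "timed_while test body s\<tau> =
     map_option (\<lambda>(s, \<tau>). (s, snd (run_state (test s) \<tau>)))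
       (while_option
         (\<lambda>(s, \<tau>). fst (run_state (test s) \<tau>))
         (\<lambda>(s, \<tau>). run_state (body s) (snd (run_state (test s) \<tau>)))
         s\<tau>)"

section \<open>The merge algorithm\<close>

text \<open>The lists of index sets, of sets of OD pairs and of price levels, and the position \<open>k\<close>.\<close>

type_synonym 'd merge_state = "nat set list \<times> 'd set list \<times> real list \<times> nat"

definition init_prog ::
  "('d set \<Rightarrow> real) \<Rightarrow> ('d set \<Rightarrow> nat) \<Rightarrow> nat \<Rightarrow> (nat \<Rightarrow> 'd set) \<Rightarrow> 'd merge_state timed" where
  "init_prog med T_med \<kappa> Dk = do {
     Is \<leftarrow> State_Monad.traverse_list (\<lambda>k. charge 1 {k}) [1..<\<kappa> + 1];
     Ds \<leftarrow> State_Monad.traverse_list (\<lambda>k. charge (card (Dk k)) (Dk k)) [1..<\<kappa> + 1];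
     Ps \<leftarrow> State_Monad.traverse_list (\<lambda>k. charge (1 + T_med (Dk k)) (med (Dk k))) [1..<\<kappa> + 1];
     charge 1 (Is, Ds, Ps, 1)
   }"

definition loop_test :: "'d merge_state \<Rightarrow> bool timed" where
  "loop_test = (\<lambda>(Is, Ds, Ps, k). do { n \<leftarrow> length_of Ps; charge 1 (k \<noteq> n) })"

definition merge_op ::
  "('d set \<Rightarrow> real) \<Rightarrow> ('d set \<Rightarrow> nat) \<Rightarrow> 'd merge_state \<Rightarrow> 'd merge_state timed" where
  "merge_op med T_med = (\<lambda>(Is, Ds, Ps, k). do {
     A \<leftarrow> read_at Is k;
     B \<leftarrow> read_at Is (k + 1);
     AB \<leftarrow> unite A B;
     Is \<leftarrow> write_at Is k AB;
     E \<leftarrow> read_at Ds k;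
     F \<leftarrow> read_at Ds (k + 1);
     EF \<leftarrow> unite E F;
     Ds \<leftarrow> write_at Ds k EF;
     m \<leftarrow> charge (T_med EF) (med EF);
     Ps \<leftarrow> write_at Ps k m;
     Is \<leftarrow> delete_at Is (k + 1);
     Ds \<leftarrow> delete_at Ds (k + 1);
     Ps \<leftarrow> delete_at Ps (k + 1);
     b \<leftarrow> charge 1 (k \<noteq> 1);
     k \<leftarrow> (if b then charge 1 (k - 1) else State_Monad.return k);
     State_Monad.return (Is, Ds, Ps, k)
   })"

definition move_op :: "'d merge_state \<Rightarrow> 'd merge_state timed" where
  "move_op = (\<lambda>(Is, Ds, Ps, k). charge 1 (Is, Ds, Ps, k + 1))"

definition loop_body ::
  "('d set \<Rightarrow> real) \<Rightarrow> ('d set \<Rightarrow> nat) \<Rightarrow> 'd merge_state \<Rightarrow> 'd merge_state timed" where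
  "loop_body med T_med = (\<lambda>(Is, Ds, Ps, k). do {
     x \<leftarrow> read_at Ps k;
     y \<leftarrow> read_at Ps (k + 1);
     b \<leftarrow> charge 1 (x > y);
     (if b then merge_op med T_med (Is, Ds, Ps, k) else move_op (Is, Ds, Ps, k))
   })"

definition output_prog :: "(nat \<Rightarrow> real) \<Rightarrow> 'd merge_state \<Rightarrow> (nat \<Rightarrow> real) timed" where
  "output_prog p = (\<lambda>(Is, Ds, Ps, k). do {
     n \<leftarrow> length_of Ps;
     for_each (\<lambda>l p. do {
         A \<leftarrow> read_at Is l;
         x \<leftarrow> read_at Ps l;
         charge (card A) (\<lambda>k. if k \<in> A then x else p k)
       }) [1..<n + 1] p
   })"

text \<open>
  The returned price vector together with the number of elementary operations performed, or \<open>None\<close>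
  if the algorithm does not terminate. The prices $p_k$ chosen at the start are the values
  \<open>med (Dk k)\<close> already computed in the initialization.
\<close>

definition merge_algorithm ::
  "('d set \<Rightarrow> real) \<Rightarrow> ('d set \<Rightarrow> nat) \<Rightarrow> nat \<Rightarrow> (nat \<Rightarrow> 'd set) \<Rightarrow> ((nat \<Rightarrow> real) \<times> nat) option" where
  "merge_algorithm med T_med \<kappa> Dk =
     map_option (\<lambda>(s, \<tau>). run_state (output_prog (\<lambda>k. med (Dk k)) s) \<tau>)
       (timed_while loop_test (loop_body med T_med) (run_state (init_prog med T_med \<kappa> Dk) 0))"

end

theory Submission
  imports Defs
begin

text \<open>
  The algorithm is pool-adjacent-violators for the \<open>L\<^sup>1\<close> loss. Call a block \<open>A\<close> of consecutive
  indices constant-optimal if, among all prices that are increasing on \<open>A\<close>, none has a smaller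
  deviation on \<open>A\<close> than the best single price for all of \<open>A\<close>. If \<open>{1..\<kappa>}\<close> is cut into
  constant-optimal blocks whose medians increase from block to block, then these medians are
  feasible and attain a lower bound on every block separately, so they are optimal. This is the
  situation when the loop stops.

  Single indices are constant-optimal because a weighted median minimizes the weighted sum of
  distances. The heart of the proof is that merging preserves constant-optimality: if two such blocks
  are given, \<open>A\<close> to the left of \<open>B\<close>, and the median of \<open>A\<close> is at least that of \<open>B\<close>, then any increasing prices on
  \<open>A \<union> B\<close> can be replaced, without loss, by one common price between the two medians
  (\<open>constant_optimal_Un\<close>). Medians need not be unique, and an arbitrary choice of them is harmless:
  the property of being constant-optimal depends only on the value of the minimum, not on the
  minimizer.

  For the running time, let \<open>n\<close> be the current number of blocks and \<open>k\<close> the current position. A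
  move lowers \<open>2 * n - k\<close> by one; a merge lowers it by one, or by two at position 1. So there are
  fewer than \<open>2 * \<kappa>\<close> iterations. Each costs \<open>O(card D)\<close>, since all lists have length at most
  \<open>\<kappa> \<le> card D\<close> and all sets of OD pairs are subsets of \<open>D\<close>.

  The three lists of the algorithm are determined by the list of index sets alone, so the loop
  invariant and the potential are formulated for that list and the position.
\<close>

section \<open>Blocks on which constants are optimal\<close>

definition constant_optimal :: "('i::linorder \<Rightarrow> real \<Rightarrow> real) \<Rightarrow> 'i set \<Rightarrow> real \<Rightarrow> bool" where
  "constant_optimal f A m \<longleftrightarrow>
     (\<forall>p. mono_on A p \<longrightarrow> (\<Sum>k\<in>A. f k m) \<le> (\<Sum>k\<in>A. f k (p k)))"

text \<open>
  This property (Wright convexity) follows from convexity and is the only form in which the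
  convexity of the deviation is used: the further to the right a shift by a fixed amount starts, the
  more it costs.
\<close>

definition increasing_increments :: "(real \<Rightarrow> real) \<Rightarrow> bool" where
  "increasing_increments f \<longleftrightarrow>
     (\<forall>x y h. x \<le> y \<longrightarrow> 0 \<le> h \<longrightarrow> f (x + h) - f x \<le> f (y + h) - f y)"

text \<open>
  To the left of the optimal constant \<open>m\<close>, the constant \<open>x\<close> is still no worse than any increasing
  prices below it. Shifting such prices upwards by \<open>m - x\<close> turns \<open>x\<close> into \<open>m\<close>, which is optimal; undoing the shift
  favours \<open>x\<close>, because the increments of the prices below \<open>x\<close> are the smaller ones.
\<close>

lemma constant_optimal_below:
  assumes opt: "constant_optimal f A m"
    and incr: "\<And>k. k \<in> A \<Longrightarrow> increasing_increments (f k)"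
    and p: "mono_on A p" "\<And>k. k \<in> A \<Longrightarrow> p k \<le> x" and x: "x \<le> m"
  shows "(\<Sum>k\<in>A. f k x) \<le> (\<Sum>k\<in>A. f k (p k))"
proof -
  define q where "q k = p k + (m - x)" for k
  have "mono_on A q"
    using p(1) by (auto simp: q_def mono_on_def)
  then have "(\<Sum>k\<in>A. f k m) \<le> (\<Sum>k\<in>A. f k (q k))"
    using opt by (auto simp: constant_optimal_def)
  then have "0 \<le> (\<Sum>k\<in>A. f k (q k) - f k m)"
    by (simp add: sum_subtractf)
  also have "\<dots> \<le> (\<Sum>k\<in>A. f k (p k) - f k x)"
  proof (rule sum_mono)
    fix k assume "k \<in> A"
    then have "f k (p k + (m - x)) - f k (p k) \<le> f k (x + (m - x)) - f k x"
      using incr p(2) x unfolding increasing_increments_def by (metis diff_ge_0_iff_ge)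
    then show "f k (q k) - f k m \<le> f k (p k) - f k x"
      by (simp add: q_def)
  qed
  finally show ?thesis
    by (simp add: sum_subtractf)
qed

text \<open>
  The mirror image of the preceding lemma, with a shift downwards.
\<close>

lemma constant_optimal_above:
  assumes opt: "constant_optimal f A m"
    and incr: "\<And>k. k \<in> A \<Longrightarrow> increasing_increments (f k)"
    and p: "mono_on A p" "\<And>k. k \<in> A \<Longrightarrow> x \<le> p k" and x: "m \<le> x"
  shows "(\<Sum>k\<in>A. f k x) \<le> (\<Sum>k\<in>A. f k (p k))"
proof -
  define q where "q k = p k - (x - m)" for k
  have "mono_on A q"
    using p(1) by (auto simp: q_def mono_on_def)
  then have "(\<Sum>k\<in>A. f k m) \<le> (\<Sum>k\<in>A. f k (q k))"
    using opt by (auto simp: constant_optimal_def)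
  then have "0 \<le> (\<Sum>k\<in>A. f k (q k) - f k m)"
    by (simp add: sum_subtractf)
  also have "\<dots> \<le> (\<Sum>k\<in>A. f k (p k) - f k x)"
  proof (rule sum_mono)
    fix k assume k: "k \<in> A"
    have "m \<le> q k"
      using p(2)[OF k] by (simp add: q_def)
    then have "f k (m + (x - m)) - f k m \<le> f k (q k + (x - m)) - f k (q k)"
      using incr[OF k] x unfolding increasing_increments_def by (metis diff_ge_0_iff_ge)
    then show "f k (q k) - f k m \<le> f k (p k) - f k x"
      by (simp add: q_def)
  qed
  finally show ?thesis
    by (simp add: sum_subtractf)
qed

text \<open>
  The merge step. Given increasing prices \<open>p\<close>, let \<open>a\<close> be the last of them on \<open>A\<close>, so that \<open>a\<close>
  separates the prices on \<open>A\<close> from those on \<open>B\<close>. Project \<open>a\<close> to the interval \<open>[m2, m1]\<close>. The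
  resulting constant \<open>x\<close> is no worse than \<open>p\<close> on either block: it is the optimal constant of the
  block, or the block's prices lie on the side of \<open>x\<close> that one of the two preceding lemmas needs.
  The constant \<open>m\<close> enters only through its value, hence it may lie outside \<open>[m2, m1]\<close>.
\<close>

lemma constant_optimal_Un:
  fixes A B :: "'a::linorder set"
  assumes A: "constant_optimal f A m1" "finite A" "A \<noteq> {}"
    and B: "constant_optimal f B m2" "finite B"
    and less: "\<forall>i\<in>A. \<forall>j\<in>B. i < j"
    and m12: "m2 \<le> m1"
    and incr: "\<And>k. k \<in> A \<union> B \<Longrightarrow> increasing_increments (f k)"
    and min: "\<And>x. (\<Sum>k\<in>A \<union> B. f k m) \<le> (\<Sum>k\<in>A \<union> B. f k x)"
  shows "constant_optimal f (A \<union> B) m"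
  unfolding constant_optimal_def
proof (intro allI impI)
  fix p :: "'a \<Rightarrow> real"
  assume p: "mono_on (A \<union> B) p"
  then have pA: "mono_on A p" and pB: "mono_on B p"
    by (auto simp: mono_on_def)
  define a where "a = p (Max A)"
  have Max: "Max A \<in> A"
    using A by simp
  have leA: "p k \<le> a" if "k \<in> A" for k
    using that p Max A(2) by (auto simp: a_def mono_on_def)
  have geB: "a \<le> p k" if "k \<in> B" for k
    using that p Max less unfolding a_def by (intro mono_onD[OF p]) (auto intro: less_imp_le)
  define x where "x = max m2 (min m1 a)"
  have "(\<Sum>k\<in>A. f k x) \<le> (\<Sum>k\<in>A. f k (p k))"
  proof (cases "a \<le> m1")
    case True
    then have "a \<le> x" "x \<le> m1"
      using m12 by (auto simp: x_def)
    then show ?thesis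
      using leA incr by (intro constant_optimal_below[OF A(1) _ pA]) (auto intro: order_trans)
  next
    case False
    then have "x = m1"
      using m12 by (simp add: x_def)
    then show ?thesis
      using A(1) pA by (simp add: constant_optimal_def)
  qed
  moreover have "(\<Sum>k\<in>B. f k x) \<le> (\<Sum>k\<in>B. f k (p k))"
  proof (cases "m2 \<le> a")
    case True
    then have "x \<le> a" "m2 \<le> x"
      by (auto simp: x_def)
    then show ?thesis
      using geB incr by (intro constant_optimal_above[OF B(1) _ pB]) (auto intro: order_trans)
  next
    case False
    then have "x = m2"
      by (simp add: x_def)
    then show ?thesis
      using B(1) pB by (simp add: constant_optimal_def)
  qed
  moreover have "A \<inter> B = {}"
    using less by auto
  ultimately have "(\<Sum>k\<in>A \<union> B. f k x) \<le> (\<Sum>k\<in>A \<union> B. f k (p k))"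
    using A(2) B(2) by (simp add: sum.union_disjoint)
  with min[of x] show "(\<Sum>k\<in>A \<union> B. f k m) \<le> (\<Sum>k\<in>A \<union> B. f k (p k))"
    by linarith
qed

section \<open>Weighted medians\<close>

definition deviation :: "('d \<Rightarrow> real) \<Rightarrow> ('d \<Rightarrow> nat) \<Rightarrow> 'd set \<Rightarrow> real \<Rightarrow> real" where
  "deviation r t X x = (\<Sum>d\<in>X. real (t d) * \<bar>r d - x\<bar>)"

lemma increasing_increments_deviation: "increasing_increments (deviation r t X)"
proof -
  have "\<bar>s - (x + h)\<bar> - \<bar>s - x\<bar> \<le> \<bar>s - (y + h)\<bar> - \<bar>s - y\<bar>"
    if "x \<le> y" "0 \<le> h" for s x y h :: real
    using that by linarith
  then show ?thesis
    unfolding increasing_increments_def deviation_def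
    by (auto simp: sum_subtractf[symmetric] right_diff_distrib[symmetric]
        intro!: sum_mono mult_left_mono)
qed

text \<open>
  Moving the price from \<open>p\<close> to \<open>x > p\<close> increases the distance by \<open>x - p\<close> for every reference price up
  to \<open>p\<close> and decreases it by at most \<open>x - p\<close> for the others, which have at most half of the total
  weight. The case \<open>x < p\<close> is symmetric.
\<close>

lemma deviation_w_median_le:
  assumes "finite X" and p: "p \<in> w_median r t X"
  shows "deviation r t X p \<le> deviation r t X x"
proof -
  define W where "W = (\<Sum>d\<in>X. real (t d))"
  have lower: "2 * (\<Sum>d | d \<in> X \<and> r d < p. real (t d)) \<le> W"
    and upper: "2 * (\<Sum>d | d \<in> X \<and> p < r d. real (t d)) \<le> W"
    using p unfolding w_median_def mem_Collect_eq W_def by linarith+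
  \<comment> \<open>Each distance is bounded to change by \<open>h\<close>, or by \<open>-h\<close> on the side \<open>P\<close> the price moves to.\<close>
  have *: "(\<Sum>d\<in>X. real (t d) * (h * (1 - 2 * of_bool (P d))))
      = h * (W - 2 * (\<Sum>d | d \<in> X \<and> P d. real (t d)))" for h and P
  proof -
    have "(\<Sum>d | d \<in> X \<and> P d. real (t d)) = (\<Sum>d\<in>X. real (t d) * of_bool (P d))"
      using \<open>finite X\<close> by (intro sum.mono_neutral_cong_left) auto
    moreover have "(\<Sum>d\<in>X. real (t d) * (h * (1 - 2 * of_bool (P d))))
        = (\<Sum>d\<in>X. h * (real (t d) - 2 * (real (t d) * of_bool (P d))))"
      by (intro sum.cong) (auto simp: of_bool_def)
    ultimately show ?thesis
      by (simp only: W_def sum_distrib_left[symmetric] sum_subtractf)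
  qed
  have "0 \<le> (\<Sum>d\<in>X. real (t d) * (\<bar>r d - x\<bar> - \<bar>r d - p\<bar>))"
  proof (cases "p \<le> x")
    case True
    have "0 \<le> (x - p) * (W - 2 * (\<Sum>d | d \<in> X \<and> p < r d. real (t d)))"
      using True upper by (intro mult_nonneg_nonneg) simp_all
    also have "\<dots> \<le> (\<Sum>d\<in>X. real (t d) * (\<bar>r d - x\<bar> - \<bar>r d - p\<bar>))"
      unfolding *[symmetric] using True by (intro sum_mono mult_left_mono) (auto simp: of_bool_def abs_if)
    finally show ?thesis .
  next
    case False
    have "0 \<le> (p - x) * (W - 2 * (\<Sum>d | d \<in> X \<and> r d < p. real (t d)))"
      using False lower by (intro mult_nonneg_nonneg) simp_all
    also have "\<dots> \<le> (\<Sum>d\<in>X. real (t d) * (\<bar>r d - x\<bar> - \<bar>r d - p\<bar>))"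
      unfolding *[symmetric] using False by (intro sum_mono mult_left_mono) (auto simp: of_bool_def abs_if)
    finally show ?thesis .
  qed
  then show ?thesis
    by (simp add: deviation_def right_diff_distrib sum_subtractf)
qed

text \<open>
  Below zero all of the weight, and hence more than half of it, lies above the price. So the
  constraint \<open>0 \<le> p 1\<close> takes care of itself.
\<close>

lemma w_median_nonneg:
  assumes "finite X" "X \<noteq> {}" "\<And>d. d \<in> X \<Longrightarrow> 0 \<le> r d" "\<And>d. d \<in> X \<Longrightarrow> 1 \<le> t d"
    and p: "p \<in> w_median r t X"
  shows "0 \<le> p"
proof (rule ccontr)
  assume "\<not> 0 \<le> p"
  then have "p < r d" if "d \<in> X" for d
    using assms(3)[OF that] by simp
  then have "{d. d \<in> X \<and> p < r d} = X"
    by blast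
  moreover have "0 < (\<Sum>d\<in>X. real (t d))"
    using assms(1,2,4) by (intro sum_pos) (auto simp: Suc_le_eq)
  ultimately show False
    using p unfolding w_median_def mem_Collect_eq by simp
qed

section \<open>Running the programs\<close>

lemma run_state_charge [simp]: "run_state (charge n x) \<tau> = (x, \<tau> + n)"
  by (simp add: charge_def State_Monad.update_def)

lemma run_state_traverse_list_charge:
  "run_state (State_Monad.traverse_list (\<lambda>k. charge (g k) (h k)) xs) \<tau>
     = (map h xs, \<tau> + sum_list (map g xs))"
  by (induction xs arbitrary: \<tau>) auto

lemma run_state_for_each_append:
  "run_state (for_each f (xs @ ys) a) \<tau> =
     (case run_state (for_each f xs a) \<tau> of (a', \<tau>') \<Rightarrow> run_state (for_each f ys a') \<tau>')"
  by (induction xs arbitrary: a \<tau>) (auto split: prod.split)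

section \<open>Medians of blocks of indices\<close>

locale median_pricing =
  fixes D :: "'d set" and r :: "'d \<Rightarrow> real" and t :: "'d \<Rightarrow> nat" and \<kappa> :: nat
    and Dk :: "nat \<Rightarrow> 'd set" and c :: real
    and med :: "'d set \<Rightarrow> real" and T_med :: "'d set \<Rightarrow> nat"
  assumes inst: "pricing_instance D r t \<kappa> Dk"
    and median: "linear_time_median c D r t med T_med"
begin

definition items :: "nat set \<Rightarrow> 'd set" where
  "items A = (\<Union>k\<in>A. Dk k)"

definition price :: "nat set \<Rightarrow> real" where
  "price A = med (items A)"

definition cost :: "nat \<Rightarrow> real \<Rightarrow> real" where
  "cost k = deviation r t (Dk k)"

text \<open>
  All states of a run have this form: every entry of the second and third list is the set of OD
  pairs, respectively the computed median, belonging to the index set at the same position.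
\<close>

definition list_state :: "nat set list \<Rightarrow> nat \<Rightarrow> 'd merge_state" where
  "list_state As k = (As, map items As, map price As, k)"

abbreviation precedes :: "nat set \<Rightarrow> nat set \<Rightarrow> bool" where
  "precedes A B \<equiv> \<forall>i\<in>A. \<forall>j\<in>B. i < j"

definition block_partition :: "nat set list \<Rightarrow> bool" where
  "block_partition As \<longleftrightarrow> sorted_wrt precedes As \<and> {} \<notin> set As \<and> \<Union> (set As) = {1..\<kappa>}"

text \<open>
  Sortedness is claimed only up to the current position. Beyond it no prices have been compared yet,
  and a merge may drop the price at the position below its left neighbour, which is why the
  algorithm then steps back by one.
\<close>

definition merge_inv :: "nat set list \<Rightarrow> nat \<Rightarrow> bool" where
  "merge_inv As k \<longleftrightarrow>
     block_partition As \<and> (\<forall>A\<in>set As. constant_optimal cost A (price A)) \<and>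
     length As \<le> \<kappa> \<and> 1 \<le> k \<and> k \<le> length As \<and> sorted (map price (take k As))"

lemma finite_Dk: "k \<in> {1..\<kappa>} \<Longrightarrow> finite (Dk k)"
  using inst by (auto simp: pricing_instance_def)

lemma items_subset: "A \<subseteq> {1..\<kappa>} \<Longrightarrow> items A \<subseteq> D"
  using inst by (force simp: pricing_instance_def items_def)

lemma finite_items: "A \<subseteq> {1..\<kappa>} \<Longrightarrow> finite (items A)"
  using items_subset inst by (metis finite_subset pricing_instance_def)

lemma items_nonempty:
  assumes "A \<subseteq> {1..\<kappa>}" "A \<noteq> {}"
  shows "items A \<noteq> {}"
proof -
  obtain k where "k \<in> A"
    using assms by blast
  then have "Dk k \<noteq> {}"
    using assms inst unfolding pricing_instance_def by blast
  with \<open>k \<in> A\<close> show ?thesis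
    by (auto simp: items_def)
qed

lemma items_singleton [simp]: "items {k} = Dk k"
  by (simp add: items_def)

lemma items_Un: "items (A \<union> B) = items A \<union> items B"
  by (auto simp: items_def)

lemma items_disjoint:
  assumes "A \<subseteq> {1..\<kappa>}" "B \<subseteq> {1..\<kappa>}" "A \<inter> B = {}"
  shows "items A \<inter> items B = {}"
proof -
  have "Dk i \<inter> Dk j = {}" if "i \<in> A" "j \<in> B" for i j
    using that assms inst unfolding pricing_instance_def
    by (intro disjoint_family_onD[of Dk "{1..\<kappa>}"]) blast+
  then show ?thesis
    by (auto simp: items_def)
qed

lemma card_items:
  assumes "A \<subseteq> {1..\<kappa>}"
  shows "card (items A) = (\<Sum>k\<in>A. card (Dk k))"
proof -
  have "disjoint_family_on Dk A" "finite A"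
    using assms inst by (auto simp: pricing_instance_def intro: disjoint_family_on_mono finite_subset)
  then show ?thesis
    using assms finite_Dk unfolding items_def disjoint_family_on_def
    by (intro card_UN_disjoint) auto
qed

lemma items_all: "items {1..\<kappa>} = D"
  using inst by (simp add: pricing_instance_def items_def)

lemma card_D: "card D = (\<Sum>k\<in>{1..\<kappa>}. card (Dk k))"
  using card_items[of "{1..\<kappa>}"] items_all by (simp del: One_nat_def)

lemma \<kappa>_le_card: "\<kappa> \<le> card D"
proof -
  have "(\<Sum>k\<in>{1..\<kappa>}. 1) \<le> (\<Sum>k\<in>{1..\<kappa>}. card (Dk k))"
    using inst finite_Dk by (intro sum_mono) (auto simp: pricing_instance_def Suc_le_eq card_gt_0_iff)
  then show ?thesis
    by (simp add: card_D)
qed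

lemma \<kappa>_pos: "1 \<le> \<kappa>"
  using inst by (simp add: pricing_instance_def)

lemma price_median:
  assumes "A \<subseteq> {1..\<kappa>}" "A \<noteq> {}"
  shows "price A \<in> w_median r t (items A)"
  using median items_subset[OF assms(1)] items_nonempty[OF assms]
  by (simp add: linear_time_median_def price_def)

lemma T_med_le:
  assumes "A \<subseteq> {1..\<kappa>}" "A \<noteq> {}"
  shows "real (T_med (items A)) \<le> \<bar>c\<bar> * card (items A)"
proof -
  have "real (T_med (items A)) \<le> c * card (items A)"
    using median items_subset[OF assms(1)] items_nonempty[OF assms]
    by (simp add: linear_time_median_def)
  also have "\<dots> \<le> \<bar>c\<bar> * card (items A)"
    by (intro mult_right_mono) auto
  finally show ?thesis .
qed

lemma price_nonneg:
  assumes "A \<subseteq> {1..\<kappa>}" "A \<noteq> {}"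
  shows "0 \<le> price A"
proof (rule w_median_nonneg[OF finite_items items_nonempty _ _ price_median])
  show "0 \<le> r d" "1 \<le> t d" if "d \<in> items A" for d
    using that items_subset[OF assms(1)] inst by (auto simp: pricing_instance_def)
qed (use assms in auto)

lemma sum_cost:
  assumes "A \<subseteq> {1..\<kappa>}"
  shows "(\<Sum>k\<in>A. cost k x) = deviation r t (items A) x"
proof -
  have "disjoint_family_on Dk A" "finite A"
    using assms inst by (auto simp: pricing_instance_def intro: disjoint_family_on_mono finite_subset)
  then show ?thesis
    using assms finite_Dk unfolding items_def disjoint_family_on_def cost_def deviation_def
    by (intro sum.UNION_disjoint[symmetric]) auto
qed

lemma price_minimizes:
  assumes "A \<subseteq> {1..\<kappa>}" "A \<noteq> {}"
  shows "(\<Sum>k\<in>A. cost k (price A)) \<le> (\<Sum>k\<in>A. cost k x)"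
  using assms deviation_w_median_le[OF finite_items price_median] by (simp add: sum_cost)

section \<open>The loop invariant\<close>

lemma merge_inv_init: "merge_inv (map (\<lambda>k. {k}) [1..<\<kappa> + 1]) 1"
proof -
  have "sorted_wrt precedes (map (\<lambda>k. {k}) [1..<\<kappa> + 1])"
    unfolding sorted_wrt_map by (rule sorted_wrt_mono_rel[OF _ sorted_wrt_upt]) simp
  moreover have "constant_optimal cost {k} (price {k})" if "k \<in> {1..\<kappa>}" for k
    using that price_minimizes[of "{k}"] by (auto simp: constant_optimal_def)
  moreover have "take 1 (map (\<lambda>k. {k}) [1..<\<kappa> + 1]) = [{1}]"
    using \<kappa>_pos by (simp add: upt_conv_Cons del: upt_Suc)
  ultimately show ?thesis
    using \<kappa>_pos by (auto simp: merge_inv_def block_partition_def)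
qed

text \<open>
  At the first position the algorithm cannot step back, hence the \<open>max\<close>; there the sorted part
  consists of a single price.
\<close>

lemma merge_inv_merge:
  assumes inv: "merge_inv (U @ A # B # V) (Suc (length U))" and gt: "price A > price B"
  shows "merge_inv (U @ (A \<union> B) # V) (max 1 (length U))"
proof -
  have sub: "A \<union> B \<subseteq> {1..\<kappa>}" and ne: "A \<noteq> {}" "B \<noteq> {}"
    and opt: "constant_optimal cost A (price A)" "constant_optimal cost B (price B)"
    and prec: "precedes A B"
    using inv by (auto simp: merge_inv_def block_partition_def sorted_wrt_append)
  have "finite (A \<union> B)"
    using sub by (rule finite_subset) simp
  then have "constant_optimal cost (A \<union> B) (price (A \<union> B))"
    using opt prec ne gt price_minimizes[OF sub]
    by (intro constant_optimal_Un[of cost A "price A" B "price B"])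
      (auto simp: cost_def increasing_increments_deviation)
  moreover have "block_partition (U @ (A \<union> B) # V)"
    using inv by (auto simp: merge_inv_def block_partition_def sorted_wrt_append)
  moreover have "sorted (map price (take (max 1 (length U)) (U @ (A \<union> B) # V)))"
    using inv by (cases U) (auto simp: merge_inv_def sorted_append max_def)
  ultimately show ?thesis
    using inv by (auto simp: merge_inv_def)
qed

lemma merge_inv_move:
  assumes inv: "merge_inv (U @ A # B # V) (Suc (length U))" and le: "price A \<le> price B"
  shows "merge_inv (U @ A # B # V) (Suc (Suc (length U)))"
  using inv le by (auto simp: merge_inv_def sorted_append)

section \<open>Number of elementary operations\<close>

text \<open>
  Twelve is the number of list accesses during a comparison followed by a merge; the two further
  elementary steps are the tests of the prices and of the position, and a step back costs one more.
\<close>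

lemma run_loop_body_merge:
  assumes "price A > price B" and n: "n = length (U @ A # B # V)"
  shows "run_state (loop_body med T_med (list_state (U @ A # B # V) (Suc (length U)))) \<tau>
    = (list_state (U @ (A \<union> B) # V) (max 1 (length U)),
       \<tau> + 12 * n + 2 + of_bool (U \<noteq> []) + card A + card B + card (items A) + card (items B)
         + T_med (items (A \<union> B)))"
  using assms
  by (auto simp: loop_body_def merge_op_def list_state_def read_at_def write_at_def delete_at_def
      unite_def nth_append list_update_append items_Un price_def algebra_simps Suc_le_eq max_def)

lemma run_loop_body_move:
  assumes "price A \<le> price B" and n: "n = length (U @ A # B # V)"
  shows "run_state (loop_body med T_med (list_state (U @ A # B # V) (Suc (length U)))) \<tau>
    = (list_state (U @ A # B # V) (Suc (Suc (length U))), \<tau> + 2 * n + 2)"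
  using assms
  by (auto simp: loop_body_def move_op_def list_state_def read_at_def nth_append)

lemma run_loop_test:
  "run_state (loop_test (list_state As k)) \<tau> = (k \<noteq> length As, \<tau> + length As + 1)"
  by (simp add: loop_test_def list_state_def length_of_def)

text \<open>
  The factor 17 is \<open>12 + 2 + 1\<close> from the list accesses and tests, plus one each for uniting two index
  sets and two sets of OD pairs. Since \<open>1 \<le> \<kappa> \<le> card D\<close>, each of these
  units is at most \<open>card D\<close>; the median subroutine contributes the rest.
\<close>

lemma loop_step:
  assumes inv: "merge_inv As k" and k: "k \<noteq> length As"
  obtains As' k' \<tau>' where
    "run_state (loop_body med T_med (list_state As k)) \<tau> = (list_state As' k', \<tau>')"
    "merge_inv As' k'" "2 * length As' - k' < 2 * length As - k"
    "real \<tau>' \<le> real \<tau> + (17 + \<bar>c\<bar>) * card D"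
proof -
  have kb: "1 \<le> k" "k < length As"
    using inv k by (auto simp: merge_inv_def)
  define U V A B where "U = take (k - 1) As" and "V = drop (k + 1) As"
    and "A = As ! (k - 1)" and "B = As ! k"
  have As: "As = U @ A # B # V"
    using kb unfolding U_def V_def A_def B_def
    by (metis Cons_nth_drop_Suc Suc_eq_plus1 Suc_diff_1 append_take_drop_id less_imp_diff_less
        less_eq_Suc_le One_nat_def)
  have k: "k = Suc (length U)"
    using kb by (simp add: U_def)
  have n: "length As \<le> \<kappa>"
    using inv by (simp add: merge_inv_def)
  have \<kappa>: "1 \<le> \<kappa>" "\<kappa> \<le> card D"
    by (fact \<kappa>_pos \<kappa>_le_card)+
  show ?thesis
  proof (cases "price A > price B")
    case True
    let ?\<tau> = "\<tau> + 12 * length As + 2 + of_bool (U \<noteq> []) + card A + card B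
      + card (items A) + card (items B) + T_med (items (A \<union> B))"
    have sub: "A \<subseteq> {1..\<kappa>}" "B \<subseteq> {1..\<kappa>}" and ne: "A \<noteq> {}" and dis: "A \<inter> B = {}"
      using inv As by (auto simp: merge_inv_def block_partition_def sorted_wrt_append)
    have "finite A" "finite B"
      using sub by (auto intro: finite_subset)
    then have "card A + card B = card (A \<union> B)"
      using dis by (simp add: card_Un_disjoint)
    also have "\<dots> \<le> \<kappa>"
      using sub card_mono[of "{1..\<kappa>}" "A \<union> B"] by simp
    finally have idx: "card A + card B \<le> \<kappa>" .
    have "card (items A) + card (items B) = card (items (A \<union> B))"
      using sub dis by (simp add: items_Un card_Un_disjoint finite_items items_disjoint)
    also have le: "\<dots> \<le> card D"
      using sub items_subset[of "A \<union> B"] inst by (auto simp: pricing_instance_def intro: card_mono)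
    finally have its: "card (items A) + card (items B) \<le> card D" .
    have "real (T_med (items (A \<union> B))) \<le> \<bar>c\<bar> * card (items (A \<union> B))"
      using sub ne by (intro T_med_le) auto
    also have "\<dots> \<le> \<bar>c\<bar> * card D"
      using le by (intro mult_left_mono) auto
    finally have T: "real (T_med (items (A \<union> B))) \<le> \<bar>c\<bar> * card D" .
    have "12 * length As + 2 + of_bool (U \<noteq> []) + card A + card B
      + card (items A) + card (items B) \<le> 17 * card D"
      using n \<kappa> idx its by (auto simp: of_bool_def)
    then have "real (12 * length As + 2 + of_bool (U \<noteq> []) + card A + card B
      + card (items A) + card (items B)) \<le> real (17 * card D)"
      by (rule of_nat_mono)
    then have time: "real ?\<tau> \<le> real \<tau> + (17 + \<bar>c\<bar>) * card D"
      using T by (simp add: algebra_simps)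
    have run: "run_state (loop_body med T_med (list_state As k)) \<tau>
        = (list_state (U @ (A \<union> B) # V) (max 1 (length U)), ?\<tau>)"
      unfolding k As using run_loop_body_merge[OF True refl] by simp
    have inv': "merge_inv (U @ (A \<union> B) # V) (max 1 (length U))"
      using merge_inv_merge inv True unfolding k As by blast
    show ?thesis
      by (rule that[OF run inv' _ time]) (auto simp: k As)
  next
    case False
    have "2 * length As + 2 \<le> 17 * card D"
      using n \<kappa> by linarith
    then have "real (2 * length As + 2) \<le> real (17 * card D)"
      by (rule of_nat_mono)
    moreover have "0 \<le> \<bar>c\<bar> * card D"
      by simp
    ultimately have time: "real (\<tau> + 2 * length As + 2) \<le> real \<tau> + (17 + \<bar>c\<bar>) * card D"
      unfolding distrib_right by linarith
    have run: "run_state (loop_body med T_med (list_state As k)) \<tau>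
        = (list_state As (Suc (Suc (length U))), \<tau> + 2 * length As + 2)"
      unfolding k As using run_loop_body_move[OF _ refl] False by simp
    have inv': "merge_inv As (Suc (Suc (length U)))"
      using merge_inv_move inv False unfolding k As by simp
    show ?thesis
      by (rule that[OF run inv' _ time]) (auto simp: k As)
  qed
qed

lemma run_init:
  obtains \<tau> where
    "run_state (init_prog med T_med \<kappa> Dk) 0 = (list_state (map (\<lambda>k. {k}) [1..<\<kappa> + 1]) 1, \<tau>)"
    "real \<tau> \<le> (4 + \<bar>c\<bar>) * card D"
proof -
  let ?\<tau> = "\<kappa> + (\<Sum>k\<in>{1..\<kappa>}. card (Dk k)) + (\<Sum>k\<in>{1..\<kappa>}. 1 + T_med (Dk k)) + 1"
  have set: "set [1..<\<kappa> + 1] = {1..\<kappa>}"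
    by auto
  have run: "run_state (init_prog med T_med \<kappa> Dk) 0 = (list_state (map (\<lambda>k. {k}) [1..<\<kappa> + 1]) 1, ?\<tau>)"
    unfolding init_prog_def list_state_def
    by (simp only: run_state_bind run_state_traverse_list_charge run_state_charge split
        interv_sum_list_conv_sum_set_nat set map_map o_def items_singleton price_def) simp
  have "(\<Sum>k\<in>{1..\<kappa>}. real (T_med (Dk k))) \<le> (\<Sum>k\<in>{1..\<kappa>}. \<bar>c\<bar> * card (Dk k))"
    using T_med_le[of "{_}"] by (intro sum_mono) auto
  then have "(\<Sum>k\<in>{1..\<kappa>}. real (T_med (Dk k))) \<le> \<bar>c\<bar> * card D"
    by (simp add: card_D sum_distrib_left)
  moreover have "real ?\<tau> = 2 * real \<kappa> + real (card D) + (\<Sum>k\<in>{1..\<kappa>}. real (T_med (Dk k))) + 1"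
    by (simp add: card_D sum.distrib)
  moreover have "1 \<le> real \<kappa>" "real \<kappa> \<le> real (card D)"
    using \<kappa>_pos \<kappa>_le_card by auto
  ultimately have "real ?\<tau> \<le> (4 + \<bar>c\<bar>) * card D"
    unfolding distrib_right by linarith
  with run show ?thesis
    by (rule that)
qed

text \<open>
  Amortized analysis: the steps performed so far plus \<open>W\<close> per unit of the potential
  \<open>2 * length As - k\<close> never increase. Here \<open>W\<close> bounds one iteration including its test, which costs at
  most \<open>2 * card D\<close>. The same potential yields termination.
\<close>

lemma run_loop:
  obtains As \<tau> where
    "timed_while loop_test (loop_body med T_med) (run_state (init_prog med T_med \<kappa> Dk) 0)
       = Some (list_state As (length As), \<tau>)"
    "merge_inv As (length As)" "real \<tau> \<le> (6 + \<bar>c\<bar>) * card D + 2 * \<kappa> * ((19 + \<bar>c\<bar>) * card D)"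
proof -
  define W where "W = (19 + \<bar>c\<bar>) * card D"
  define As0 :: "nat set list" where "As0 = map (\<lambda>k. {k}) [1..<\<kappa> + 1]"
  have W: "0 \<le> W"
    by (simp add: W_def)
  obtain \<tau>0 where init: "run_state (init_prog med T_med \<kappa> Dk) 0 = (list_state As0 1, \<tau>0)"
    and \<tau>0: "real \<tau>0 \<le> (4 + \<bar>c\<bar>) * card D"
    unfolding As0_def by (rule run_init)
  let ?test = "\<lambda>(s, \<tau>). fst (run_state (loop_test s) \<tau>)"
  let ?body = "\<lambda>(s, \<tau>). run_state (loop_body med T_med s) (snd (run_state (loop_test s) \<tau>))"
  define P where "P = (\<lambda>(s, \<tau>). \<exists>As k. s = list_state As k \<and> merge_inv As k \<and>
    real \<tau> + real (2 * length As - k) * W \<le> (4 + \<bar>c\<bar>) * card D + 2 * \<kappa> * W)"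
  define potential :: "'d merge_state \<times> nat \<Rightarrow> nat"
    where "potential = (\<lambda>((As, _, _, k), _). 2 * length As - k)"
  have potential_eq: "potential (list_state As k, \<tau>) = 2 * length As - k" for As k \<tau>
    by (simp add: potential_def list_state_def)
  have step: "P (?body s) \<and> potential (?body s) < potential s" if "P s" "?test s" for s
  proof -
    obtain As k \<tau> where s: "s = (list_state As k, \<tau>)" and inv: "merge_inv As k"
      and bound: "real \<tau> + real (2 * length As - k) * W \<le> (4 + \<bar>c\<bar>) * card D + 2 * \<kappa> * W"
      using \<open>P s\<close> by (auto simp: P_def)
    have k: "k \<noteq> length As"
      using \<open>?test s\<close> by (simp add: s run_loop_test)
    obtain As' k' \<tau>' where body:
        "run_state (loop_body med T_med (list_state As k)) (\<tau> + length As + 1)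
          = (list_state As' k', \<tau>')"
      and inv': "merge_inv As' k'" and dec: "2 * length As' - k' < 2 * length As - k"
      and \<tau>': "real \<tau>' \<le> real (\<tau> + length As + 1) + (17 + \<bar>c\<bar>) * card D"
      by (rule loop_step[OF inv k])
    have "length As + 1 \<le> 2 * card D"
      using inv \<kappa>_pos \<kappa>_le_card by (simp add: merge_inv_def)
    then have "real (length As + 1) \<le> real (2 * card D)"
      by (rule of_nat_mono)
    then have "real \<tau>' \<le> real \<tau> + W"
      using \<tau>' by (simp add: W_def distrib_right)
    moreover have "real (2 * length As' - k') + 1 \<le> real (2 * length As - k)"
      using dec by linarith
    then have "(real (2 * length As' - k') + 1) * W \<le> real (2 * length As - k) * W"
      using W by (rule mult_right_mono)
    ultimately have "real \<tau>' + real (2 * length As' - k') * W \<le> (4 + \<bar>c\<bar>) * card D + 2 * \<kappa> * W"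
      using bound by (simp add: distrib_right)
    with inv' have "P (list_state As' k', \<tau>')"
      unfolding P_def by blast
    moreover have "?body s = (list_state As' k', \<tau>')"
      using body by (simp add: s run_loop_test)
    ultimately show ?thesis
      using dec by (simp add: s potential_eq)
  qed
  have "P (list_state As0 1, \<tau>0)"
  proof -
    have "real (2 * \<kappa> - 1) * W \<le> 2 * \<kappa> * W"
      using W by (intro mult_right_mono) auto
    moreover have "length As0 = \<kappa>"
      by (simp add: As0_def)
    ultimately have "real \<tau>0 + real (2 * length As0 - 1) * W \<le> (4 + \<bar>c\<bar>) * card D + 2 * \<kappa> * W"
      using \<tau>0 by (simp only: add_mono)
    then show ?thesis
      using merge_inv_init unfolding P_def As0_def[symmetric] by blast
  qed
  then obtain s where s: "while_option ?test ?body (list_state As0 1, \<tau>0) = Some s"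
    using measure_while_option_Some[of P ?test ?body potential, OF step] by blast
  have "P s"
    using while_option_rule[of P ?test ?body, OF _ s \<open>P (list_state As0 1, \<tau>0)\<close>] step by blast
  then obtain As k \<tau> where As: "s = (list_state As k, \<tau>)" "merge_inv As k"
    and bound: "real \<tau> + real (2 * length As - k) * W \<le> (4 + \<bar>c\<bar>) * card D + 2 * \<kappa> * W"
    by (auto simp: P_def)
  have k: "k = length As"
    using while_option_stop[OF s] As by (simp add: run_loop_test)
  have "timed_while loop_test (loop_body med T_med) (run_state (init_prog med T_med \<kappa> Dk) 0)
      = Some (list_state As (length As), \<tau> + length As + 1)"
    unfolding timed_while_def init s by (simp add: As k run_loop_test)
  moreover have "merge_inv As (length As)"
    using As k by simp
  moreover have "real (\<tau> + length As + 1) \<le> (6 + \<bar>c\<bar>) * card D + 2 * \<kappa> * W"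
  proof -
    have "length As + 1 \<le> 2 * card D"
      using As(2) \<kappa>_pos \<kappa>_le_card by (simp add: merge_inv_def)
    then have "real (length As + 1) \<le> real (2 * card D)"
      by (rule of_nat_mono)
    moreover have "0 \<le> real (2 * length As - k) * W"
      using W by simp
    ultimately show ?thesis
      using bound unfolding distrib_right by linarith
  qed
  ultimately show ?thesis
    unfolding W_def by (rule that)
qed

lemma block_partition_less:
  assumes "block_partition As" "a < b" "b < length As" "i \<in> As ! a" "j \<in> As ! b"
  shows "i < j"
proof -
  have "precedes (As ! a) (As ! b)"
    using assms(1) sorted_wrt_nth_less[of precedes As a b] assms(2,3) unfolding block_partition_def
    by blast
  then show ?thesis
    using assms(4,5) by blast
qed

text \<open>
  The blocks are disjoint, so that later assignments do not overwrite earlier ones.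
\<close>

lemma run_output:
  assumes "block_partition As" "length As \<le> \<kappa>"
  obtains p' \<tau>' where
    "run_state (output_prog p (list_state As k)) \<tau> = (p', \<tau>')"
    "\<And>A k. A \<in> set As \<Longrightarrow> k \<in> A \<Longrightarrow> p' k = price A"
    "\<tau>' \<le> \<tau> + 4 * (\<kappa> * \<kappa>)"
proof -
  let ?n = "length As"
  let ?f = "\<lambda>l p. State_Monad.bind (read_at As l) (\<lambda>A. State_Monad.bind (read_at (map price As) l)
    (\<lambda>x. charge (card A) (\<lambda>k. if k \<in> A then x else p k)))"
  have sub: "A \<subseteq> {1..\<kappa>}" if "A \<in> set As" for A
    using that assms(1) by (auto simp: block_partition_def)
  have dis: "As ! i \<inter> As ! j = {}" if "i < j" "j < ?n" for i j
    using block_partition_less[OF assms(1) that] by blast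
  have *: "\<exists>p' \<tau>'. run_state (for_each ?f [1..<m + 1] p) (\<tau> + ?n) = (p', \<tau>') \<and>
      (\<forall>l<m. \<forall>k\<in>As ! l. p' k = price (As ! l)) \<and> \<tau>' \<le> \<tau> + ?n + m * (3 * \<kappa>)" if "m \<le> ?n" for m
    using that
  proof (induction m)
    case 0
    then show ?case by simp
  next
    case (Suc m)
    then obtain p' \<tau>' where IH: "run_state (for_each ?f [1..<m + 1] p) (\<tau> + ?n) = (p', \<tau>')"
      "\<forall>l<m. \<forall>k\<in>As ! l. p' k = price (As ! l)" "\<tau>' \<le> \<tau> + ?n + m * (3 * \<kappa>)"
      by auto
    define q where "q = (\<lambda>k. if k \<in> As ! m then price (As ! m) else p' k)"
    have "[1..<Suc m + 1] = [1..<m + 1] @ [Suc m]"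
      by simp
    then have "run_state (for_each ?f [1..<Suc m + 1] p) (\<tau> + ?n)
        = (q, \<tau>' + 2 * ?n + card (As ! m))"
      unfolding \<open>[1..<Suc m + 1] = _\<close> run_state_for_each_append IH(1)
      using Suc.prems by (simp add: read_at_def q_def)
    moreover have "\<forall>l<Suc m. \<forall>k\<in>As ! l. q k = price (As ! l)"
      using IH(2) dis[of _ m] Suc.prems by (fastforce simp: q_def less_Suc_eq)
    moreover have "card (As ! m) \<le> \<kappa>"
      using sub[of "As ! m"] Suc.prems card_mono[of "{1..\<kappa>}" "As ! m"] by simp
    then have "\<tau>' + 2 * ?n + card (As ! m) \<le> \<tau> + ?n + Suc m * (3 * \<kappa>)"
      using IH(3) assms(2) by simp
    ultimately show ?case
      by blast
  qed
  obtain p' \<tau>' where p': "run_state (for_each ?f [1..<?n + 1] p) (\<tau> + ?n) = (p', \<tau>')"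
    "\<forall>l<?n. \<forall>k\<in>As ! l. p' k = price (As ! l)" "\<tau>' \<le> \<tau> + ?n + ?n * (3 * \<kappa>)"
    using *[of ?n] by blast
  have "run_state (output_prog p (list_state As k)) \<tau> = (p', \<tau>')"
    using p'(1) by (simp add: output_prog_def list_state_def length_of_def)
  moreover have "p' k = price A" if "A \<in> set As" "k \<in> A" for A k
    using that p'(2) by (auto simp: in_set_conv_nth)
  moreover have "?n * (3 * \<kappa>) \<le> 3 * (\<kappa> * \<kappa>)" "?n \<le> \<kappa> * \<kappa>"
    using mult_le_mono1[OF assms(2), of "3 * \<kappa>"] order_trans[OF assms(2) le_square]
    by simp_all
  then have "\<tau>' \<le> \<tau> + 4 * (\<kappa> * \<kappa>)"
    using p'(3) by linarith
  ultimately show ?thesis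
    by (rule that)
qed

section \<open>Optimality of the computed prices\<close>

lemma monotone_prices_mono_on:
  assumes "monotone_prices \<kappa> p"
  shows "mono_on {1..\<kappa>} p"
proof (rule mono_onI)
  fix i j assume ij: "i \<in> {1..\<kappa>}" "j \<in> {1..\<kappa>}" "i \<le> j"
  from \<open>i \<le> j\<close> have "j \<le> \<kappa> \<longrightarrow> p i \<le> p j"
  proof (induction rule: dec_induct)
    case (step n)
    then show ?case
      using assms ij(1) by (force simp: monotone_prices_def intro: order_trans)
  qed simp
  then show "p i \<le> p j"
    using ij by simp
qed

lemma total_deviation_blocks:
  assumes "block_partition As"
  shows "total_deviation r t \<kappa> Dk p = (\<Sum>A\<in>set As. \<Sum>k\<in>A. cost k (p k))"
proof -
  have "total_deviation r t \<kappa> Dk p = (\<Sum>k\<in>\<Union> (set As). cost k (p k))"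
    using assms by (simp add: total_deviation_def cost_def deviation_def block_partition_def)
  also have "\<dots> = (\<Sum>A\<in>set As. \<Sum>k\<in>A. cost k (p k))"
  proof (subst sum.Union_disjoint)
    show "\<forall>A\<in>set As. finite A"
      using assms unfolding block_partition_def
      by (metis Union_upper finite_atLeastAtMost finite_subset)
    show "\<forall>A\<in>set As. \<forall>B\<in>set As. A \<noteq> B \<longrightarrow> A \<inter> B = {}"
    proof (intro ballI impI)
      fix A B assume "A \<in> set As" "B \<in> set As" "A \<noteq> B"
      then obtain i j where ij: "A = As ! i" "B = As ! j" "i < length As" "j < length As" "i \<noteq> j"
        by (auto simp: in_set_conv_nth)
      then show "A \<inter> B = {}"
        using block_partition_less[OF assms, of i j] block_partition_less[OF assms, of j i]
        by (cases i j rule: linorder_cases) blast+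
    qed
  qed simp
  finally show ?thesis .
qed

text \<open>
  Feasibility comes from the sorted prices. Optimality is shown block by block, since every feasible
  price vector is increasing on each block and is beaten there by the block's constant.
\<close>

lemma final_prices_optimal:
  assumes inv: "merge_inv As (length As)"
    and p: "\<And>A k. A \<in> set As \<Longrightarrow> k \<in> A \<Longrightarrow> p k = price A"
  shows "is_arg_min (total_deviation r t \<kappa> Dk) (monotone_prices \<kappa>) p"
proof -
  have part: "block_partition As" and opt: "\<And>A. A \<in> set As \<Longrightarrow> constant_optimal cost A (price A)"
    and sorted: "sorted (map price As)"
    using inv by (auto simp: merge_inv_def)
  have Un: "\<Union> (set As) = {1..\<kappa>}" and ne: "{} \<notin> set As"
    using part by (auto simp: block_partition_def)
  have "p i \<le> p j" if ij: "i \<in> {1..\<kappa>}" "j \<in> {1..\<kappa>}" "i \<le> j" for i j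
  proof -
    obtain a b where ab: "a < length As" "i \<in> As ! a" "b < length As" "j \<in> As ! b"
      using ij Un by (metis UnionE in_set_conv_nth)
    have "\<not> b < a"
      using block_partition_less[OF part _ ab(1), of b j i] ab ij by auto
    then have "price (As ! a) \<le> price (As ! b)"
      using sorted_nth_mono[OF sorted, of a b] ab by simp
    then show ?thesis
      using p[of "As ! a" i] p[of "As ! b" j] ab by simp
  qed
  moreover have "0 \<le> p 1"
  proof -
    obtain A where "A \<in> set As" "1 \<in> A"
      using Un \<kappa>_pos by (metis UnionE atLeastAtMost_iff order_refl)
    then show ?thesis
      using p price_nonneg[of A] Un by auto
  qed
  ultimately have "monotone_prices \<kappa> p"
    by (auto simp: monotone_prices_def)
  moreover have "total_deviation r t \<kappa> Dk p \<le> total_deviation r t \<kappa> Dk q"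
    if "monotone_prices \<kappa> q" for q
    unfolding total_deviation_blocks[OF part]
  proof (rule sum_mono)
    fix A assume A: "A \<in> set As"
    have "mono_on A q"
      using monotone_prices_mono_on[OF that] A Un by (auto intro: mono_on_subset)
    then have "(\<Sum>k\<in>A. cost k (price A)) \<le> (\<Sum>k\<in>A. cost k (q k))"
      using opt[OF A] by (simp add: constant_optimal_def)
    then show "(\<Sum>k\<in>A. cost k (p k)) \<le> (\<Sum>k\<in>A. cost k (q k))"
      using p[OF A] by simp
  qed
  ultimately show ?thesis
    by (auto simp: is_arg_min_def not_less)
qed

text \<open>
  In units of \<open>\<kappa> * card D\<close>, the initialization and the last test of the loop account for
  \<open>6 + \<bar>c\<bar>\<close>, the iterations of the loop for \<open>2 * (19 + \<bar>c\<bar>)\<close> and the output for \<open>4\<close>. The absolute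
  value makes the bounds monotone in the cardinalities for every real \<open>c\<close>.
\<close>

lemma merge_algorithm_correct:
  "\<exists>p \<tau>. merge_algorithm med T_med \<kappa> Dk = Some (p, \<tau>) \<and>
     is_arg_min (total_deviation r t \<kappa> Dk) (monotone_prices \<kappa>) p \<and>
     real \<tau> \<le> (48 + 3 * \<bar>c\<bar>) * (real \<kappa> * real (card D))"
proof -
  obtain As \<tau> where loop:
      "timed_while loop_test (loop_body med T_med) (run_state (init_prog med T_med \<kappa> Dk) 0)
        = Some (list_state As (length As), \<tau>)"
    and inv: "merge_inv As (length As)"
    and \<tau>: "real \<tau> \<le> (6 + \<bar>c\<bar>) * card D + 2 * \<kappa> * ((19 + \<bar>c\<bar>) * card D)"
    by (rule run_loop)
  have "block_partition As" "length As \<le> \<kappa>"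
    using inv by (simp_all add: merge_inv_def)
  then obtain p \<tau>' where out:
      "run_state (output_prog (\<lambda>k. med (Dk k)) (list_state As (length As))) \<tau> = (p, \<tau>')"
    and p: "\<And>A k. A \<in> set As \<Longrightarrow> k \<in> A \<Longrightarrow> p k = price A" and \<tau>': "\<tau>' \<le> \<tau> + 4 * (\<kappa> * \<kappa>)"
    by (rule run_output) blast
  have "merge_algorithm med T_med \<kappa> Dk = Some (p, \<tau>')"
    by (simp add: merge_algorithm_def loop out)
  moreover have "is_arg_min (total_deviation r t \<kappa> Dk) (monotone_prices \<kappa>) p"
    by (rule final_prices_optimal[OF inv p])
  moreover have "real \<tau>' \<le> (48 + 3 * \<bar>c\<bar>) * (real \<kappa> * real (card D))"
  proof -
    define X where "X = real \<kappa> * real (card D)"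
    have "\<tau>' \<le> \<tau> + 4 * (\<kappa> * card D)"
      using \<tau>' \<kappa>_le_card by (meson add_left_mono mult_le_mono2 order_trans)
    then have "real \<tau>' \<le> real \<tau> + 4 * X"
      unfolding X_def by (metis of_nat_add of_nat_le_iff of_nat_mult of_nat_numeral)
    moreover have "(6 + \<bar>c\<bar>) * card D \<le> (6 + \<bar>c\<bar>) * X"
      unfolding X_def using \<kappa>_pos by (intro mult_left_mono) (auto simp: mult_le_cancel_right1)
    moreover have "2 * \<kappa> * ((19 + \<bar>c\<bar>) * card D) = 2 * (19 + \<bar>c\<bar>) * X"
      by (simp add: X_def)
    ultimately show ?thesis
      using \<tau> unfolding X_def[symmetric] by (simp add: algebra_simps)
  qed
  ultimately show ?thesis
    by blast
qed

end

theorem theorem35: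
  fixes c :: real
  shows "\<exists>C::real. \<forall>(D :: 'd set) (r :: 'd \<Rightarrow> real) (t :: 'd \<Rightarrow> nat) (\<kappa> :: nat) (Dk :: nat \<Rightarrow> 'd set)
           (med :: 'd set \<Rightarrow> real) (T_med :: 'd set \<Rightarrow> nat).
           pricing_instance D r t \<kappa> Dk \<longrightarrow> linear_time_median c D r t med T_med \<longrightarrow>
           (\<exists>p \<tau>. merge_algorithm med T_med \<kappa> Dk = Some (p, \<tau>) \<and>
              is_arg_min (total_deviation r t \<kappa> Dk) (monotone_prices \<kappa>) p \<and>
              real \<tau> \<le> C * (real \<kappa> * real (card D)))"
  by (rule exI[of _ "48 + 3 * \<bar>c\<bar>"])
    (blast intro: median_pricing.merge_algorithm_correct median_pricing.intro)

end
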